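(* Let $D$ and $D'$ be integral domains. If the ordered monoids $\mathcal{K}(D)$ and $\mathcal{K}(D')$ are isomorphic, then the lattices of all semistar operations on $D$ and on $D'$, respectively, are isomorphic.
   Context: For an integral domain $D$ with quotient field $F$, $\mathcal{K}(D)$ is the set of all nonzero $D$-submodules of $F$, ordered by inclusion and equipped with the usual product of $D$-submodules; it is an ordered monoid (a monoid with a partial order for which multiplication is order-preserving in both variables). Isomorphisms of ordered monoids are monoid isomorphisms that are also order isomorphisms. A closure operation on a poset is a self-map $\star$ that is expansive ($x \le x^\star$), order-preserving and idempotent. A semistar operation on $D$ is a closure operation $\star$ on the poset $\mathcal{K}(D)$ such that $(aI)^\star = aI^\star$ for all nonzero $a \in F$ and all $I \in \mathcal{K}(D)$. The set of semistar operations on $D$ is partially ordered by $\star_1 \le \star_2$ iff $I^{\star_1} \subseteq I^{\star_2}$ for all $I \in \mathcal{K}(D)$ (this is a complete lattice). *)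

theory Defs
  imports
    "HOL-Computational_Algebra.Polynomial_Factorial"
    "HOL-Algebra.Group"
    "HOL-Algebra.Complete_Lattice"
    "HOL-Library.FuncSet"
begin

section \<open>The ordered monoid of nonzero submodules of the quotient field\<close>

text \<open>An integral domain is a type \<open>'a\<close> of class \<open>idom\<close>, and its quotient field is the type
  \<open>'a fract\<close>.  Submodules and spans are those of the locale \<open>module\<close>, for the multiplication of
  fractions by elements of the domain.\<close>

definition fract_scale :: "'a::idom \<Rightarrow> 'a fract \<Rightarrow> 'a fract"
  where "fract_scale d x = to_fract d * x"

interpretation fract_module: module "fract_scale :: 'a::idom \<Rightarrow> 'a fract \<Rightarrow> 'a fract"
  by standard (simp_all add: fract_scale_def algebra_simps)

definition nonzero_submodules :: "'a::idom fract set set"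
  where "nonzero_submodules = {I. fract_module.subspace I \<and> I \<noteq> {0}}"

definition submodule_mult :: "'a::idom fract set \<Rightarrow> 'a fract set \<Rightarrow> 'a fract set"
  where "submodule_mult I J = fract_module.span {x * y | x y. x \<in> I \<and> y \<in> J}"

text \<open>The \<open>monoid\<close> and \<open>gorder\<close> records of HOL-Algebra have no common extension, so the ordered
  monoid is given by its monoid part and its order part, which have the same carrier.\<close>

definition submodule_monoid :: "'a::idom itself \<Rightarrow> 'a fract set monoid"
  where "submodule_monoid _ =
    \<lparr>carrier = nonzero_submodules, mult = submodule_mult, one = range to_fract\<rparr>"

definition submodule_order :: "'a::idom itself \<Rightarrow> 'a fract set gorder"
  where "submodule_order _ = \<lparr>carrier = nonzero_submodules, eq = (=), le = (\<subseteq>)\<rparr>"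

section \<open>Semistar operations\<close>

text \<open>Self-maps of a carrier are extensional, so that they are equal as soon as they agree on the
  carrier.\<close>

definition closure_operation :: "('a, 'm) gorder_scheme \<Rightarrow> ('a \<Rightarrow> 'a) \<Rightarrow> bool"
  where "closure_operation L c \<longleftrightarrow>
    c \<in> carrier L \<rightarrow>\<^sub>E carrier L \<and>
    (\<forall>x\<in>carrier L. x \<sqsubseteq>\<^bsub>L\<^esub> c x) \<and> isotone L L c \<and> idempotent L c"

definition semistar_operation :: "('a::idom fract set \<Rightarrow> 'a fract set) \<Rightarrow> bool"
  where "semistar_operation c \<longleftrightarrow>
    closure_operation (submodule_order TYPE('a)) c \<and>
    (\<forall>a. a \<noteq> 0 \<longrightarrow> (\<forall>I\<in>nonzero_submodules. c ((\<lambda>x. a * x) ` I) = (\<lambda>x. a * x) ` c I))"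

definition semistar_lattice :: "'a::idom itself \<Rightarrow> ('a fract set \<Rightarrow> 'a fract set) gorder"
  where "semistar_lattice _ =
    \<lparr>carrier = {c. semistar_operation c}, eq = (=),
     le = (\<lambda>c d. \<forall>I\<in>nonzero_submodules. c I \<subseteq> d I)\<rparr>"

definition lattice_iso :: "('a, 'm) gorder_scheme \<Rightarrow> ('b, 'n) gorder_scheme \<Rightarrow> ('a \<Rightarrow> 'b) set"
  where "lattice_iso L M =
    {f. bij_betw f (carrier L) (carrier M) \<and> join_pres L M f \<and> meet_pres L M f}"

section \<open>The structures are as expected\<close>

lemma partial_order_submodule_order: "partial_order (submodule_order TYPE('a::idom))"
  by unfold_locales (auto simp: submodule_order_def)

lemma subspace_range_to_fract: "fract_module.subspace (range (to_fract :: 'a::idom \<Rightarrow> _))"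
proof -
  have "0 \<in> range (to_fract :: 'a \<Rightarrow> _)"
    by (metis rangeI to_fract_0)
  then show ?thesis
    by (auto simp: fract_module.subspace_def fract_scale_def
        simp flip: to_fract_add to_fract_mult)
qed

lemma subspace_submodule_mult: "fract_module.subspace (submodule_mult I J)"
  by (simp add: submodule_mult_def)

lemma submodule_multI: "x \<in> I \<Longrightarrow> y \<in> J \<Longrightarrow> x * y \<in> submodule_mult I J"
  unfolding submodule_mult_def by (rule fract_module.span_base) blast

lemma submodule_mult_least:
  assumes "\<And>x y. x \<in> I \<Longrightarrow> y \<in> J \<Longrightarrow> x * y \<in> S" and "fract_module.subspace S"
  shows "submodule_mult I J \<subseteq> S"
  unfolding submodule_mult_def using assms by (intro fract_module.span_minimal) auto

lemma submodule_mult_mono: "I \<subseteq> I' \<Longrightarrow> J \<subseteq> J' \<Longrightarrow> submodule_mult I J \<subseteq> submodule_mult I' J'"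
  unfolding submodule_mult_def by (rule fract_module.span_mono) blast

lemma submodule_mult_commute: "submodule_mult I J = submodule_mult J I"
proof -
  have "{x * y | x y. x \<in> I \<and> y \<in> J} = {x * y | x y. x \<in> J \<and> y \<in> I}"
    by (auto simp: mult.commute) (metis mult.commute)+
  then show ?thesis by (simp add: submodule_mult_def)
qed

lemma subspace_mult_vimage:
  assumes "fract_module.subspace S"
  shows "fract_module.subspace {x. x * z \<in> S}"
  using assms
  by (auto simp: fract_module.subspace_def fract_scale_def distrib_right mult.assoc)

lemma submodule_mult_assoc_le:
  "submodule_mult (submodule_mult I J) K \<subseteq> submodule_mult I (submodule_mult J K)"
proof (rule submodule_mult_least)
  fix x z assume x: "x \<in> submodule_mult I J" and z: "z \<in> K"
  have "submodule_mult I J \<subseteq> {x. x * z \<in> submodule_mult I (submodule_mult J K)}"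
    by (rule submodule_mult_least)
      (auto simp: mult.assoc z intro!: submodule_multI subspace_mult_vimage subspace_submodule_mult)
  with x show "x * z \<in> submodule_mult I (submodule_mult J K)" by auto
qed (rule subspace_submodule_mult)

lemma submodule_mult_assoc:
  "submodule_mult (submodule_mult I J) K = submodule_mult I (submodule_mult J K)"
  by (metis subset_antisym submodule_mult_assoc_le submodule_mult_commute)

lemma submodule_mult_one:
  assumes "fract_module.subspace I"
  shows "submodule_mult (range to_fract) I = I"
proof
  show "submodule_mult (range to_fract) I \<subseteq> I"
    using assms by (intro submodule_mult_least) (auto simp: fract_module.subspace_def fract_scale_def)
  show "I \<subseteq> submodule_mult (range to_fract) I"
    by (metis mult_1 rangeI submodule_multI subsetI to_fract_1)
qed

lemma nonzero_submodules_iff: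
  "I \<in> nonzero_submodules \<longleftrightarrow> fract_module.subspace I \<and> (\<exists>x\<in>I. x \<noteq> 0)"
  unfolding nonzero_submodules_def using fract_module.subspace_0 by auto

lemma submodule_mult_closed:
  "I \<in> nonzero_submodules \<Longrightarrow> J \<in> nonzero_submodules \<Longrightarrow> submodule_mult I J \<in> nonzero_submodules"
  unfolding nonzero_submodules_iff using submodule_multI subspace_submodule_mult
  by (metis no_zero_divisors)

lemma range_to_fract_nonzero_submodules: "range to_fract \<in> nonzero_submodules"
  unfolding nonzero_submodules_iff using subspace_range_to_fract
  by (metis rangeI to_fract_1 zero_neq_one)

lemma comm_monoid_submodule_monoid: "comm_monoid (submodule_monoid TYPE('a::idom))"
proof (rule comm_monoidI)
  show "x \<otimes>\<^bsub>submodule_monoid TYPE('a)\<^esub> y = y \<otimes>\<^bsub>submodule_monoid TYPE('a)\<^esub> x" for x y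
    unfolding submodule_monoid_def monoid.simps by (rule submodule_mult_commute)
  show "\<one>\<^bsub>submodule_monoid TYPE('a)\<^esub> \<otimes>\<^bsub>submodule_monoid TYPE('a)\<^esub> x = x"
    if "x \<in> carrier (submodule_monoid TYPE('a))" for x
    using that by (simp add: submodule_monoid_def submodule_mult_one nonzero_submodules_def)
qed (simp_all add: submodule_monoid_def submodule_mult_closed range_to_fract_nonzero_submodules
      submodule_mult_assoc)

lemma smult_nonzero_submodules:
  assumes "a \<noteq> 0" and "I \<in> nonzero_submodules"
  shows "(\<lambda>x. a * x) ` I \<in> nonzero_submodules"
proof -
  have "fract_module.subspace ((\<lambda>x. a * x) ` I)"
    using assms(2) unfolding nonzero_submodules_iff
    by (auto simp: fract_module.subspace_def fract_scale_def image_iff mult.left_commute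
        simp flip: distrib_left)
  with assms show ?thesis unfolding nonzero_submodules_iff by auto
qed

lemma semistar_operation_iff:
  "semistar_operation c \<longleftrightarrow> c \<in> nonzero_submodules \<rightarrow>\<^sub>E nonzero_submodules \<and>
    (\<forall>I\<in>nonzero_submodules. I \<subseteq> c I) \<and>
    (\<forall>I\<in>nonzero_submodules. \<forall>J\<in>nonzero_submodules. I \<subseteq> J \<longrightarrow> c I \<subseteq> c J) \<and>
    (\<forall>I\<in>nonzero_submodules. c (c I) = c I) \<and>
    (\<forall>a. a \<noteq> 0 \<longrightarrow> (\<forall>I\<in>nonzero_submodules. c ((\<lambda>x. a * x) ` I) = (\<lambda>x. a * x) ` c I))"
  using partial_order.axioms(1)[OF partial_order_submodule_order]
  by (auto simp: semistar_operation_def closure_operation_def isotone_def idempotent_def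
      submodule_order_def)

lemma partial_order_semistar_lattice: "partial_order (semistar_lattice TYPE('a::idom))"
proof unfold_locales
  fix c d assume "c \<in> carrier (semistar_lattice TYPE('a))" "d \<in> carrier (semistar_lattice TYPE('a))"
    "c \<sqsubseteq>\<^bsub>semistar_lattice TYPE('a)\<^esub> d" "d \<sqsubseteq>\<^bsub>semistar_lattice TYPE('a)\<^esub> c"
  then have "c = d"
    by (intro extensionalityI[of c nonzero_submodules d])
      (auto simp: semistar_lattice_def semistar_operation_iff PiE_def)
  then show "c .=\<^bsub>semistar_lattice TYPE('a)\<^esub> d" by (simp add: semistar_lattice_def)
qed (fastforce simp: semistar_lattice_def)+

lemma semistar_operation_INT:
  assumes "A \<noteq> {}" and A: "\<And>c. c \<in> A \<Longrightarrow> semistar_operation c"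
  shows "semistar_operation (\<lambda>I\<in>nonzero_submodules. \<Inter>c\<in>A. c I)"
proof -
  let ?c = "\<lambda>I\<in>nonzero_submodules. \<Inter>c\<in>A. c I"
  note * = A[unfolded semistar_operation_iff]
  have cl: "c I \<in> nonzero_submodules" if "c \<in> A" "I \<in> nonzero_submodules" for c I
    using PiE_mem[OF *[OF that(1), THEN conjunct1] that(2)] .
  have ex: "I \<subseteq> c I" if "c \<in> A" "I \<in> nonzero_submodules" for c I
    using *[OF that(1)] that(2) by (elim conjE) (rule bspec)
  have mo: "c I \<subseteq> c J"
    if "c \<in> A" "I \<in> nonzero_submodules" "J \<in> nonzero_submodules" "I \<subseteq> J" for c I J
    using *[OF that(1), THEN conjunct2, THEN conjunct2, THEN conjunct1] that(2-4) by (meson bspec)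
  have id: "c (c I) = c I" if "c \<in> A" "I \<in> nonzero_submodules" for c I
    using *[OF that(1)] that(2) by (elim conjE) (rule bspec)
  have sc: "c ((\<lambda>x. a * x) ` I) = (\<lambda>x. a * x) ` c I"
    if "c \<in> A" "a \<noteq> 0" "I \<in> nonzero_submodules" for c a I
    using *[OF that(1), THEN conjunct2, THEN conjunct2, THEN conjunct2, THEN conjunct2] that(2,3)
    by (meson bspec)
  have c_eq: "?c I = (\<Inter>c\<in>A. c I)" if "I \<in> nonzero_submodules" for I
    using that by simp
  have ext: "I \<subseteq> ?c I" if "I \<in> nonzero_submodules" for I
    unfolding c_eq[OF that] using ex that by blast
  have clos: "?c I \<in> nonzero_submodules" if "I \<in> nonzero_submodules" for I
  proof -
    have "fract_module.subspace (\<Inter>c\<in>A. c I)"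
      using cl[OF _ that] by (intro fract_module.subspace_Int) (simp add: nonzero_submodules_iff)
    with ext[OF that] that show ?thesis
      unfolding c_eq[OF that] nonzero_submodules_iff by blast
  qed
  have mono: "?c I \<subseteq> ?c J"
    if "I \<in> nonzero_submodules" "J \<in> nonzero_submodules" "I \<subseteq> J" for I J
    unfolding c_eq[OF that(1)] c_eq[OF that(2)] using mo[OF _ that] by blast
  have idem: "?c (?c I) = ?c I" if I: "I \<in> nonzero_submodules" for I
  proof
    have "c (?c I) \<subseteq> c I" if "c \<in> A" for c
    proof -
      have "?c I \<subseteq> c I" unfolding c_eq[OF I] using that by blast
      then show ?thesis using mo[OF that clos[OF I] cl[OF that I]] id[OF that I] by blast
    qed
    then show "?c (?c I) \<subseteq> ?c I"
      unfolding c_eq[OF clos[OF I]] unfolding c_eq[OF I] by blast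
  qed (rule ext[OF clos[OF I]])
  have scal: "?c ((\<lambda>x. a * x) ` I) = (\<lambda>x. a * x) ` ?c I"
    if a: "a \<noteq> 0" and I: "I \<in> nonzero_submodules" for a I
  proof -
    have "inj ((*) a)" using a by (simp add: inj_on_def)
    then have "(\<lambda>x. a * x) ` (\<Inter>c\<in>A. c I) = (\<Inter>c\<in>A. (\<lambda>x. a * x) ` c I)"
      using assms(1) by (metis (no_types) all_not_in_conv image_INT subset_UNIV)
    also have "\<dots> = (\<Inter>c\<in>A. c ((\<lambda>x. a * x) ` I))" using sc[OF _ a I] by simp
    finally show ?thesis
      unfolding c_eq[OF I] c_eq[OF smult_nonzero_submodules[OF a I]] by simp
  qed
  show ?thesis
    unfolding semistar_operation_iff
  proof (intro conjI ballI allI impI)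
    show "?c \<in> nonzero_submodules \<rightarrow>\<^sub>E nonzero_submodules"
      by (rule restrict_PiE_iff[THEN iffD2]) (use clos c_eq in simp)
  qed (fact ext mono idem scal)+
qed

theorem complete_lattice_semistar_lattice: "complete_lattice (semistar_lattice TYPE('a::idom))"
proof (rule partial_order.complete_lattice_criterion1[OF partial_order_semistar_lattice])
  let ?L = "semistar_lattice TYPE('a)"
  let ?t = "\<lambda>I\<in>(nonzero_submodules :: 'a fract set set). (UNIV :: 'a fract set)"
  have U: "(UNIV :: 'a fract set) \<in> nonzero_submodules"
    unfolding nonzero_submodules_iff using zero_neq_one by (metis UNIV_I fract_module.subspace_UNIV)
  have "range (\<lambda>x. a * x) = UNIV" if "a \<noteq> 0" for a :: "'a fract"
    using that by (intro surjI[of _ "\<lambda>x. x / a"]) simp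
  then have "semistar_operation ?t"
    using U by (auto simp: semistar_operation_iff smult_nonzero_submodules)
  then have "greatest ?L ?t (carrier ?L)"
    by (auto simp: greatest_def semistar_lattice_def)
  then show "\<exists>g. greatest ?L g (carrier ?L)" by blast
next
  let ?L = "semistar_lattice TYPE('a)"
  fix A assume A: "A \<subseteq> carrier ?L" "A \<noteq> {}"
  then have "semistar_operation (\<lambda>I\<in>nonzero_submodules. \<Inter>c\<in>A. c I)"
    by (intro semistar_operation_INT) (auto simp: semistar_lattice_def)
  then have "greatest ?L (\<lambda>I\<in>nonzero_submodules. \<Inter>c\<in>A. c I) (Lower ?L A)"
    using A by (auto simp: greatest_def Lower_def semistar_lattice_def)
  then show "\<exists>i. greatest ?L i (Lower ?L A)" by blast
qed

lemma lattice_iso_order_emb: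
  assumes "f \<in> lattice_iso L M"
  shows "order_emb L M f"
proof -
  have f: "bij_betw f (carrier L) (carrier M)" and "join_pres L M f"
    using assms by (auto simp: lattice_iso_def)
  then interpret L: lattice L + M: lattice M by (auto simp: join_pres_def)
  have "f x \<in> carrier M" if "x \<in> carrier L" for x using f that bij_betwE by blast
  moreover have "f (x \<squnion>\<^bsub>L\<^esub> y) = f x \<squnion>\<^bsub>M\<^esub> f y" if "x \<in> carrier L" "y \<in> carrier L" for x y
    using \<open>join_pres L M f\<close> that by (auto simp: join_pres_def)
  moreover have "f x = f y \<longleftrightarrow> x = y" if "x \<in> carrier L" "y \<in> carrier L" for x y
    using f that by (auto simp: bij_betw_def inj_on_def)
  ultimately have "f x \<sqsubseteq>\<^bsub>M\<^esub> f y \<longleftrightarrow> x \<sqsubseteq>\<^bsub>L\<^esub> y" if "x \<in> carrier L" "y \<in> carrier L" for x y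
    using that by (metis L.join_closed L.le_iff_meet M.le_iff_meet)
  then show ?thesis
    unfolding order_emb_def using L.weak_partial_order_axioms M.weak_partial_order_axioms by blast
qed

end

(* Scaling by a is multiplication by the submodule aD, but an isomorphism of ordered monoids need not
   map principal submodules to principal ones. The compatibility of a closure operation c with
   scaling is therefore rewritten in the language of ordered monoids: it is equivalent to
   I * c J <= c (I * J) for all I and J. From scaling to this, sum over the elements of I; conversely,
   apply it to aD and to its inverse. Hence conjugation by an isomorphism of the ordered
   monoids carries semistar operations to semistar operations. *)
theory Submission
  imports Defs
begin

text \<open>\<open>I\<close> absorbs multiplication by elements of the domain, and \<open>a\<close>
  itself lies in the principal submodule that it generates.\<close>

lemma smult_eq_submodule_mult:
  assumes "a \<noteq> 0" and I: "I \<in> nonzero_submodules"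
  shows "(\<lambda>x. a * x) ` I = submodule_mult ((\<lambda>x. a * x) ` range to_fract) I"
proof
  have "1 \<in> range to_fract" by (metis rangeI to_fract_1)
  then have "a \<in> (\<lambda>x. a * x) ` range to_fract" by (intro image_eqI[of _ _ 1]) simp_all
  then show "(\<lambda>x. a * x) ` I \<subseteq> submodule_mult ((\<lambda>x. a * x) ` range to_fract) I"
    by (auto intro: submodule_multI)
  have "to_fract d * y \<in> I" if "y \<in> I" for d y
    using I that by (auto simp: nonzero_submodules_iff fract_module.subspace_def fract_scale_def)
  then show "submodule_mult ((\<lambda>x. a * x) ` range to_fract) I \<subseteq> (\<lambda>x. a * x) ` I"
    using smult_nonzero_submodules[OF assms]
    by (intro submodule_mult_least) (auto simp: nonzero_submodules_iff mult.assoc)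
qed

text \<open>Each \<open>a\<close> in \<open>I\<close> satisfies \<open>a J <= I * J\<close>, so for
  nonzero \<open>a\<close> scaling and monotonicity give
  \<open>a (c J) = c (a J) <= c (I * J)\<close>. The products \<open>a * y\<close> with
  \<open>y\<close> in \<open>c J\<close> generate the left-hand side.\<close>

lemma semistar_operation_mult_le:
  assumes c: "semistar_operation c" and I: "I \<in> nonzero_submodules" and J: "J \<in> nonzero_submodules"
  shows "submodule_mult I (c J) \<subseteq> c (submodule_mult I J)"
proof (rule submodule_mult_least)
  note * = c[unfolded semistar_operation_iff]
  have cl: "c J \<in> nonzero_submodules" if "J \<in> nonzero_submodules" for J
    using * that by blast
  note IJ = submodule_mult_closed[OF I J]
  show sub: "fract_module.subspace (c (submodule_mult I J))"
    using cl[OF IJ] by (simp add: nonzero_submodules_iff)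
  fix a y assume a: "a \<in> I" and y: "y \<in> c J"
  show "a * y \<in> c (submodule_mult I J)"
  \<comment> \<open>The scaling law speaks of nonzero \<open>a\<close> only; the product for
    \<open>a = 0\<close> is 0, which lies in every submodule.\<close>
  proof (cases "a = 0")
    case True
    then show ?thesis using sub by (simp add: fract_module.subspace_0)
  next
    case False
    have "(\<lambda>x. a * x) ` c J = c ((\<lambda>x. a * x) ` J)"
      using * False J by metis
    also have "\<dots> \<subseteq> c (submodule_mult I J)"
    proof -
      have "(\<lambda>x. a * x) ` J \<subseteq> submodule_mult I J" using a by (auto intro: submodule_multI)
      then show ?thesis using * smult_nonzero_submodules[OF False J] IJ by blast
    qed
    finally show ?thesis using y by blast
  qed
qed

lemma semistar_operation_iff_mult:
  "semistar_operation c \<longleftrightarrow> c \<in> nonzero_submodules \<rightarrow>\<^sub>E nonzero_submodules \<and>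
    (\<forall>I\<in>nonzero_submodules. I \<subseteq> c I) \<and>
    (\<forall>I\<in>nonzero_submodules. \<forall>J\<in>nonzero_submodules. I \<subseteq> J \<longrightarrow> c I \<subseteq> c J) \<and>
    (\<forall>I\<in>nonzero_submodules. c (c I) = c I) \<and>
    (\<forall>I\<in>nonzero_submodules. \<forall>J\<in>nonzero_submodules.
      submodule_mult I (c J) \<subseteq> c (submodule_mult I J))" (is "_ \<longleftrightarrow> ?R")
proof
  assume "semistar_operation c"
  then show ?R using semistar_operation_mult_le[of c] by (simp add: semistar_operation_iff)
next
  assume R: ?R
  \<comment> \<open>This is the product inequality with the principal submodule generated by
    \<open>a\<close> as first factor.\<close>
  have scale_le: "(\<lambda>x. a * x) ` c I \<subseteq> c ((\<lambda>x. a * x) ` I)"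
    if a: "a \<noteq> 0" and I: "I \<in> nonzero_submodules" for a I
  proof -
    have "c I \<in> nonzero_submodules" using R I by blast
    then show ?thesis
      using R I smult_nonzero_submodules[OF a range_to_fract_nonzero_submodules]
      by (simp add: smult_eq_submodule_mult[OF a])
  qed
  have "c ((\<lambda>x. a * x) ` I) = (\<lambda>x. a * x) ` c I"
    if a: "a \<noteq> 0" and I: "I \<in> nonzero_submodules" for a I
  proof
    let ?aI = "(\<lambda>x. a * x) ` I"
    \<comment> \<open>An inequality suffices because \<open>a\<close> is invertible:
      \<open>scale_le\<close> for \<open>inverse a\<close> and \<open>?aI\<close>, multiplied by
      \<open>a\<close>, is the opposite inclusion.\<close>
    have "(\<lambda>x. inverse a * x) ` c ?aI \<subseteq> c ((\<lambda>x. inverse a * x) ` ?aI)"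
      using a by (intro scale_le smult_nonzero_submodules I) simp_all
    also have "(\<lambda>x. inverse a * x) ` ?aI = I"
      using a by (simp add: image_image flip: mult.assoc)
    finally have "(\<lambda>x. a * x) ` (\<lambda>x. inverse a * x) ` c ?aI \<subseteq> (\<lambda>x. a * x) ` c I"
      by (rule image_mono)
    then show "c ?aI \<subseteq> (\<lambda>x. a * x) ` c I"
      using a by (simp add: image_image flip: mult.assoc)
  qed (rule scale_le[OF a I])
  with R show "semistar_operation c" by (simp add: semistar_operation_iff)
qed

text \<open>The inverse \<open>k\<close> is a parameter so that the roles of \<open>h\<close> and
  \<open>k\<close> can be exchanged: by \<open>inverse\<close>, every fact proved for
  \<open>h\<close> also holds for \<open>k\<close>.\<close>

locale submodule_iso =
  fixes h :: "'a::idom fract set \<Rightarrow> 'b::idom fract set" and k :: "'b fract set \<Rightarrow> 'a fract set"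
  assumes h_closed: "I \<in> nonzero_submodules \<Longrightarrow> h I \<in> nonzero_submodules"
    and k_closed: "J \<in> nonzero_submodules \<Longrightarrow> k J \<in> nonzero_submodules"
    and k_h: "I \<in> nonzero_submodules \<Longrightarrow> k (h I) = I"
    and h_k: "J \<in> nonzero_submodules \<Longrightarrow> h (k J) = J"
    and h_le_iff: "I \<in> nonzero_submodules \<Longrightarrow> I' \<in> nonzero_submodules \<Longrightarrow> h I \<subseteq> h I' \<longleftrightarrow> I \<subseteq> I'"
    and h_mult: "I \<in> nonzero_submodules \<Longrightarrow> I' \<in> nonzero_submodules \<Longrightarrow>
      h (submodule_mult I I') = submodule_mult (h I) (h I')"
begin

lemma inverse: "submodule_iso k h"
proof
  fix J J' :: "'b fract set" assume J: "J \<in> nonzero_submodules" "J' \<in> nonzero_submodules"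
  show "k J \<subseteq> k J' \<longleftrightarrow> J \<subseteq> J'"
    using J h_le_iff[of "k J" "k J'"] by (simp add: k_closed h_k)
  show "k (submodule_mult J J') = submodule_mult (k J) (k J')"
    \<comment> \<open>Apply \<open>k\<close> to \<open>h (k J * k J') = J * J'\<close>.\<close>
    using J by (metis h_k h_mult k_closed k_h submodule_mult_closed)
qed (simp_all add: h_closed k_closed h_k k_h)

text \<open>The restriction is there because semistar operations are extensional functions on
  \<open>nonzero_submodules\<close>.\<close>

definition conj_op :: "('a fract set \<Rightarrow> 'a fract set) \<Rightarrow> 'b fract set \<Rightarrow> 'b fract set"
  where "conj_op c = (\<lambda>J\<in>nonzero_submodules. h (c (k J)))"

lemma semistar_operation_conj_op:
  assumes "semistar_operation c"
  shows "semistar_operation (conj_op c)"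
proof -
  interpret inv: submodule_iso k h by (rule inverse)
  note * = assms[unfolded semistar_operation_iff_mult]
  have cl: "c I \<in> nonzero_submodules" if "I \<in> nonzero_submodules" for I
    using * that by blast
  show ?thesis
    unfolding semistar_operation_iff_mult
  proof (intro conjI ballI impI)
    show "conj_op c \<in> nonzero_submodules \<rightarrow>\<^sub>E nonzero_submodules"
      by (auto simp: conj_op_def h_closed k_closed cl)
  next
    fix J :: "'b fract set" assume J: "J \<in> nonzero_submodules"
    then have "h (k J) \<subseteq> h (c (k J))" using * by (simp add: h_le_iff k_closed cl)
    with J show "J \<subseteq> conj_op c J" by (simp add: conj_op_def h_k)
    \<comment> \<open>The inner \<open>k\<close> and \<open>h\<close> cancel, leaving
      \<open>h (c (c (k J)))\<close>.\<close>
    show "conj_op c (conj_op c J) = conj_op c J"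
      using J * by (simp add: conj_op_def h_closed k_closed k_h cl)
  next
    fix I J :: "'b fract set" assume IJ: "I \<in> nonzero_submodules" "J \<in> nonzero_submodules"
    show "conj_op c I \<subseteq> conj_op c J" if "I \<subseteq> J"
      using IJ that * by (simp add: conj_op_def h_le_iff k_closed cl inv.h_le_iff)
    \<comment> \<open>This is the image under \<open>h\<close> of the inequality for
      \<open>c\<close> at \<open>k I\<close> and \<open>k J\<close>. Multiplicativity of
      \<open>h\<close> rewrites its left side, and that of \<open>k\<close> turns
      \<open>k I * k J\<close> into \<open>k (I * J)\<close> on the right.\<close>
    have "h (submodule_mult (k I) (c (k J))) \<subseteq> h (c (submodule_mult (k I) (k J)))"
      using IJ * by (simp add: h_le_iff k_closed cl submodule_mult_closed)
    with IJ show "submodule_mult I (conj_op c J) \<subseteq> conj_op c (submodule_mult I J)"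
      by (simp add: conj_op_def h_mult inv.h_mult h_k k_closed cl submodule_mult_closed)
  qed
qed

lemma conj_op_le_iff:
  assumes "semistar_operation c" and "semistar_operation d"
  shows "(\<forall>J\<in>nonzero_submodules. conj_op c J \<subseteq> conj_op d J) \<longleftrightarrow>
    (\<forall>I\<in>nonzero_submodules. c I \<subseteq> d I)"
proof -
  have "c I \<in> nonzero_submodules" "d I \<in> nonzero_submodules" if "I \<in> nonzero_submodules" for I
    using that assms[unfolded semistar_operation_iff, THEN conjunct1, THEN PiE_mem] by simp_all
  then show ?thesis
    \<comment> \<open>To recover the inequality at \<open>I\<close>, evaluate at
      \<open>J = h I\<close>, for which \<open>k J = I\<close>.\<close>
    by (auto simp: conj_op_def h_le_iff k_closed) (metis h_closed k_h subsetD)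
qed

text \<open>Both sides are extensional, so it is enough to cancel \<open>k\<close> against
  \<open>h\<close> twice on \<open>nonzero_submodules\<close>.\<close>

lemma conj_op_inverse:
  assumes "semistar_operation c"
  shows "submodule_iso.conj_op k h (conj_op c) = c"
proof -
  interpret inv: submodule_iso k h by (rule inverse)
  have c: "c \<in> nonzero_submodules \<rightarrow>\<^sub>E nonzero_submodules"
    using assms by (simp add: semistar_operation_iff)
  show ?thesis
  proof (rule extensionalityI[of _ nonzero_submodules])
    fix I :: "'a fract set" assume "I \<in> nonzero_submodules"
    then show "inv.conj_op (conj_op c) I = c I"
      using PiE_mem[OF c] by (simp add: inv.conj_op_def conj_op_def h_closed k_h)
  qed (use c in \<open>auto simp: inv.conj_op_def PiE_def\<close>)
qed

lemma bij_betw_conj_op: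
  "bij_betw conj_op {c. semistar_operation c} {d. semistar_operation d}"
proof -
  interpret inv: submodule_iso k h by (rule inverse)
  show ?thesis
    by (rule bij_betw_byWitness[of _ inv.conj_op])
      (auto simp: conj_op_inverse inv.conj_op_inverse semistar_operation_conj_op
        inv.semistar_operation_conj_op)
qed

end

text \<open>Joins and meets are determined by the order. This bridges the gap between comparing
  operations pointwise and the algebraic definition of \<open>lattice_iso\<close>.\<close>

lemma order_iso_imp_lattice_iso:
  assumes "lattice L" and "lattice M" and bij: "bij_betw f (carrier L) (carrier M)"
    and le_iff: "\<And>x y. x \<in> carrier L \<Longrightarrow> y \<in> carrier L \<Longrightarrow> f x \<sqsubseteq>\<^bsub>M\<^esub> f y \<longleftrightarrow> x \<sqsubseteq>\<^bsub>L\<^esub> y"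
  shows "f \<in> lattice_iso L M"
proof -
  interpret L: lattice L by fact
  interpret M: lattice M by fact
  have cl: "f x \<in> carrier M" if "x \<in> carrier L" for x
    using bij that by (rule bij_betw_apply)
  have pre: "\<exists>x\<in>carrier L. z = f x" if "z \<in> carrier M" for z
    using bij that by (auto simp: bij_betw_def)
  have join: "f (x \<squnion>\<^bsub>L\<^esub> y) = f x \<squnion>\<^bsub>M\<^esub> f y" if x: "x \<in> carrier L" and y: "y \<in> carrier L" for x y
  proof (rule M.le_antisym)
    \<comment> \<open>Surjectivity writes the join in \<open>M\<close> as \<open>f z\<close>.
      Reflecting the order makes \<open>z\<close> an upper bound of \<open>x\<close> and
      \<open>y\<close>, hence above their join in \<open>L\<close>.\<close>
    obtain z where z: "z \<in> carrier L" "f x \<squnion>\<^bsub>M\<^esub> f y = f z"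
      using pre[of "f x \<squnion>\<^bsub>M\<^esub> f y"] x y cl by auto
    have "f x \<sqsubseteq>\<^bsub>M\<^esub> f z" "f y \<sqsubseteq>\<^bsub>M\<^esub> f z"
      using M.join_left[of "f x" "f y"] M.join_right[of "f x" "f y"] z x y cl by auto
    then have "x \<squnion>\<^bsub>L\<^esub> y \<sqsubseteq>\<^bsub>L\<^esub> z" using x y z le_iff by (intro L.join_le) auto
    then show "f (x \<squnion>\<^bsub>L\<^esub> y) \<sqsubseteq>\<^bsub>M\<^esub> f x \<squnion>\<^bsub>M\<^esub> f y" using x y z le_iff by auto
    show "f x \<squnion>\<^bsub>M\<^esub> f y \<sqsubseteq>\<^bsub>M\<^esub> f (x \<squnion>\<^bsub>L\<^esub> y)"
      using x y cl le_iff by (intro M.join_le) (auto simp: L.join_left L.join_right)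
  qed (use x y cl in auto)
  have meet: "f (x \<sqinter>\<^bsub>L\<^esub> y) = f x \<sqinter>\<^bsub>M\<^esub> f y" if x: "x \<in> carrier L" and y: "y \<in> carrier L" for x y
  proof (rule M.le_antisym)
    \<comment> \<open>Dually, \<open>z\<close> is now a lower bound of \<open>x\<close> and
      \<open>y\<close>.\<close>
    obtain z where z: "z \<in> carrier L" "f x \<sqinter>\<^bsub>M\<^esub> f y = f z"
      using pre[of "f x \<sqinter>\<^bsub>M\<^esub> f y"] x y cl by auto
    have "f z \<sqsubseteq>\<^bsub>M\<^esub> f x" "f z \<sqsubseteq>\<^bsub>M\<^esub> f y"
      using M.meet_left[of "f x" "f y"] M.meet_right[of "f x" "f y"] z x y cl by auto
    then have "z \<sqsubseteq>\<^bsub>L\<^esub> x \<sqinter>\<^bsub>L\<^esub> y" using x y z le_iff by (intro L.meet_le) auto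
    then show "f x \<sqinter>\<^bsub>M\<^esub> f y \<sqsubseteq>\<^bsub>M\<^esub> f (x \<sqinter>\<^bsub>L\<^esub> y)" using x y z le_iff by auto
    show "f (x \<sqinter>\<^bsub>L\<^esub> y) \<sqsubseteq>\<^bsub>M\<^esub> f x \<sqinter>\<^bsub>M\<^esub> f y"
      using x y cl le_iff by (intro M.meet_le) (auto simp: L.meet_left L.meet_right)
  qed (use x y cl in auto)
  show ?thesis
    using assms(1-3) join meet by (simp add: lattice_iso_def join_pres_def meet_pres_def)
qed

lemma lattice_semistar_lattice: "lattice (semistar_lattice TYPE('a::idom))"
proof -
  interpret complete_lattice "semistar_lattice TYPE('a)"
    by (rule complete_lattice_semistar_lattice)
  show ?thesis by (rule lattice_axioms)
qed

theorem corollary1p3: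
  assumes "\<exists>h \<in> iso (submodule_monoid TYPE('a::idom)) (submodule_monoid TYPE('b::idom)).
    order_emb (submodule_order TYPE('a)) (submodule_order TYPE('b)) h"
  shows "\<exists>\<phi>. \<phi> \<in> lattice_iso (semistar_lattice TYPE('a)) (semistar_lattice TYPE('b))"
proof -
  obtain h :: "'a fract set \<Rightarrow> 'b fract set"
    where h: "h \<in> iso (submodule_monoid TYPE('a)) (submodule_monoid TYPE('b))"
      and emb: "order_emb (submodule_order TYPE('a)) (submodule_order TYPE('b)) h"
    using assms by blast
  have bij: "bij_betw h nonzero_submodules nonzero_submodules"
    using h by (simp add: iso_def submodule_monoid_def)
  have mult: "h (submodule_mult I J) = submodule_mult (h I) (h J)"
    if "I \<in> nonzero_submodules" "J \<in> nonzero_submodules" for I J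
    using h that by (simp add: iso_def hom_def submodule_monoid_def)
  have le_iff: "h I \<subseteq> h J \<longleftrightarrow> I \<subseteq> J"
    if "I \<in> nonzero_submodules" "J \<in> nonzero_submodules" for I J
    using emb that by (simp add: order_emb_def submodule_order_def)
  \<comment> \<open>\<open>h\<close> is known to be bijective only between the carriers, so its
    inverse is taken relative to \<open>nonzero_submodules\<close>.\<close>
  interpret submodule_iso h "inv_into nonzero_submodules h"
    using bij_betw_apply[OF bij] bij_betw_apply[OF bij_betw_inv_into[OF bij]]
      bij_betw_inv_into_left[OF bij] bij_betw_inv_into_right[OF bij] le_iff mult
    by unfold_locales
  have "conj_op \<in> lattice_iso (semistar_lattice TYPE('a)) (semistar_lattice TYPE('b))"
    by (rule order_iso_imp_lattice_iso[OF lattice_semistar_lattice lattice_semistar_lattice])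
      (simp_all add: semistar_lattice_def bij_betw_conj_op conj_op_le_iff)
  then show ?thesis by blast
qed

end
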